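(* Let $s,t,k \ge 2$ be integers and let $Y \in \{F^1_t, F^2_t\}$. The class of $\{Y, (s,t)\text{-bowtie}, (k,t)\text{-lollipop}\}$-free graphs is $(2t-2)$-strongly Pollyanna.
   Context: All graphs are finite, simple and undirected; "$H$-free" means having no induced subgraph isomorphic to $H$, and $\mathcal{H}$-free means $H$-free for every $H\in\mathcal{H}$. $\chi(G)$ is the chromatic number and $\omega(G)$ the clique number. $F^1_t$ is obtained from $K_t$ by adding two new non-adjacent vertices, each adjacent to all vertices of the $K_t$. $F^2_t$ is obtained from $K_t$ by adding three new pairwise non-adjacent vertices, each adjacent to all vertices of the $K_t$. An $(s,t)$-bowtie is obtained from the disjoint union of $K_s$ and $K_t$ by adding a new vertex adjacent to all other vertices. A $(k,t)$-lollipop is obtained from a complete graph $K_t$ and a disjoint star $S_k$ on $k$ vertices by joining the center of the star to every vertex of $K_t$. For an integer $n$, $\chi^{(n)}(G)$ denotes the maximum chromatic number of an induced subgraph $H$ of $G$ with $\omega(H)\le n$. A class $\mathcal{F}$ is $n$-good if it is hereditary and there is a constant $m$ with $\chi^{(n)}(G)\le m$ for all $G\in\mathcal{F}$. A hereditary class is polynomially $\chi$-bounded if there is a polynomial $f$ with $\chi(G)\le f(\omega(G))$ for every $G$ in the class. A class $\mathcal{C}$ is $n$-strongly Pollyanna if for every $n$-good class $\mathcal{F}$, the class $\mathcal{C}\cap\mathcal{F}$ is polynomially $\chi$-bounded. *)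

theory Defs
  imports "HOL-Library.Ramsey" "HOL-Computational_Algebra.Polynomial"
begin

section \<open>Finite simple graphs\<close>

text \<open>
  A graph is a pair of a vertex set and an edge set. The edges are two-element sets of vertices:
  \<^term>\<open>[A]\<^bsup>2\<^esup>\<close> is the set of all two-element subsets of \<^term>\<open>A\<close>. The graph without vertices is admitted.
\<close>

type_synonym 'a graph = "'a set \<times> 'a set set"

abbreviation verts :: "'a graph \<Rightarrow> 'a set" where
  "verts G \<equiv> fst G"

abbreviation edges :: "'a graph \<Rightarrow> 'a set set" where
  "edges G \<equiv> snd G"

definition simple_graph :: "'a graph \<Rightarrow> bool" where
  "simple_graph G \<longleftrightarrow> finite (verts G) \<and> edges G \<subseteq> [verts G]\<^bsup>2\<^esup>"

definition induce :: "'a graph \<Rightarrow> 'a set \<Rightarrow> 'a graph" where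
  "induce G S = (S, {e \<in> edges G. e \<subseteq> S})"

definition graph_iso :: "'a graph \<Rightarrow> 'b graph \<Rightarrow> bool" where
  "graph_iso G H \<longleftrightarrow> (\<exists>f. bij_betw f (verts G) (verts H) \<and>
     (\<forall>u\<in>verts G. \<forall>v\<in>verts G. {u, v} \<in> edges G \<longleftrightarrow> {f u, f v} \<in> edges H))"

definition free_of :: "'b graph \<Rightarrow> 'a graph \<Rightarrow> bool" where
  "free_of H G \<longleftrightarrow> \<not> (\<exists>S\<subseteq>verts G. graph_iso (induce G S) H)"

definition colourable :: "'a graph \<Rightarrow> nat \<Rightarrow> bool" where
  "colourable G k \<longleftrightarrow> (\<exists>c :: 'a \<Rightarrow> nat. (\<forall>v\<in>verts G. c v < k) \<and>
     (\<forall>u\<in>verts G. \<forall>v\<in>verts G. {u, v} \<in> edges G \<longrightarrow> c u \<noteq> c v))"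

definition chromatic_number :: "'a graph \<Rightarrow> nat" where
  "chromatic_number G = (LEAST k. colourable G k)"

definition clique_number :: "'a graph \<Rightarrow> nat" where
  "clique_number G = Max {card K | K. K \<subseteq> verts G \<and> [K]\<^bsup>2\<^esup> \<subseteq> edges G}"

definition chromatic_number_upto :: "nat \<Rightarrow> 'a graph \<Rightarrow> nat" where
  "chromatic_number_upto n G =
     Max {chromatic_number (induce G S) | S. S \<subseteq> verts G \<and> clique_number (induce G S) \<le> n}"


section \<open>Graph classes\<close>

text \<open>
  A class of graphs is a set of finite simple graphs on a common vertex type, closed under
  isomorphism. For an infinite vertex type such as \<^typ>\<open>nat\<close> every finite graph has an isomorphic
  copy on that type.
\<close>

definition graph_class :: "'a graph set \<Rightarrow> bool" where
  "graph_class \<F> \<longleftrightarrow> (\<forall>G\<in>\<F>. simple_graph G) \<and>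
     (\<forall>G\<in>\<F>. \<forall>H. simple_graph H \<and> graph_iso G H \<longrightarrow> H \<in> \<F>)"

definition hereditary :: "'a graph set \<Rightarrow> bool" where
  "hereditary \<F> \<longleftrightarrow> graph_class \<F> \<and> (\<forall>G\<in>\<F>. \<forall>S\<subseteq>verts G. induce G S \<in> \<F>)"

definition free_class :: "'b graph set \<Rightarrow> 'a graph set" where
  "free_class \<H> = {G. simple_graph G \<and> (\<forall>H\<in>\<H>. free_of H G)}"

definition good :: "nat \<Rightarrow> 'a graph set \<Rightarrow> bool" where
  "good n \<F> \<longleftrightarrow> hereditary \<F> \<and> (\<exists>m. \<forall>G\<in>\<F>. chromatic_number_upto n G \<le> m)"

definition polynomially_chi_bounded :: "'a graph set \<Rightarrow> bool" where
  "polynomially_chi_bounded \<F> \<longleftrightarrow> hereditary \<F> \<and>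
     (\<exists>f :: real poly. \<forall>G\<in>\<F>. real (chromatic_number G) \<le> poly f (real (clique_number G)))"

definition strongly_pollyanna :: "nat \<Rightarrow> 'a graph set \<Rightarrow> bool" where
  "strongly_pollyanna n \<C> \<longleftrightarrow> (\<forall>\<F>. good n \<F> \<longrightarrow> polynomially_chi_bounded (\<C> \<inter> \<F>))"


section \<open>The forbidden graphs\<close>

text \<open>The clique is \<^term>\<open>{..<t}\<close>; the new vertices are \<open>t, t + 1\<close> (and \<open>t + 2\<close> for \<open>F2\<close>).\<close>

definition F1 :: "nat \<Rightarrow> nat graph" where
  "F1 t = ({..<t + 2}, [{..<t}]\<^bsup>2\<^esup> \<union> {{u, v} | u v. u \<in> {..<t} \<and> v \<in> {t..<t + 2}})"

definition F2 :: "nat \<Rightarrow> nat graph" where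
  "F2 t = ({..<t + 3}, [{..<t}]\<^bsup>2\<^esup> \<union> {{u, v} | u v. u \<in> {..<t} \<and> v \<in> {t..<t + 3}})"

text \<open>The cliques are \<^term>\<open>{..<s}\<close> and \<^term>\<open>{s..<s + t}\<close>; the new vertex is \<^term>\<open>s + t\<close>.\<close>

definition bowtie :: "nat \<Rightarrow> nat \<Rightarrow> nat graph" where
  "bowtie s t = ({..<s + t + 1},
     [{..<s}]\<^bsup>2\<^esup> \<union> [{s..<s + t}]\<^bsup>2\<^esup> \<union> {{u, s + t} | u. u \<in> {..<s + t}})"

text \<open>
  The clique is \<^term>\<open>{..<t}\<close>; the star has the \<open>k\<close> vertices \<^term>\<open>{t..<t + k}\<close>, that is, the
  centre \<open>t\<close> and \<open>k - 1\<close> leaves.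
\<close>

definition lollipop :: "nat \<Rightarrow> nat \<Rightarrow> nat graph" where
  "lollipop k t = ({..<t + k},
     [{..<t}]\<^bsup>2\<^esup> \<union> {{t, v} | v. v \<in> {t<..<t + k}} \<union> {{u, t} | u. u \<in> {..<t}})"

end

theory Submission
  imports Defs
begin

text \<open>
  Let \<open>\<omega>\<close> be the clique number of \<open>G\<close> and suppose that the vertex \<open>v\<close> lies in a clique \<open>K\<close> of size
  \<open>2t - 1\<close>. A neighbour \<open>u\<close> of \<open>v\<close> outside \<open>K\<close> with at least \<open>t\<close> neighbours in \<open>K\<close> is complete to a
  \<open>t\<close>-subset of \<open>K\<close>; the vertices complete to a fixed \<open>t\<close>-clique contain no independent triple, so
  there are at most \<open>\<omega> + \<omega>\<^sup>2\<close> of them. Any other neighbour \<open>u\<close> is anticomplete to a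
  \<open>t\<close>-subset of \<open>K - {v}\<close>; for a fixed \<open>t\<close>-subset these vertices contain neither a clique of size \<open>s\<close>
  (bowtie centred at \<open>v\<close>) nor an independent set of size \<open>k - 1\<close> (lollipop centred at \<open>v\<close>), so their
  number is bounded by a Ramsey number. Hence the vertices in cliques of size \<open>2t - 1\<close> have degree
  polynomial in \<open>\<omega>\<close> and are coloured greedily, while the remaining vertices induce a graph of clique
  number at most \<open>2t - 2\<close>.
\<close>

section \<open>Clique number and colourings\<close>

lemma simple_graph_edgeD:
  assumes "simple_graph G" and "{u, v} \<in> edges G"
  shows "u \<in> verts G" and "v \<in> verts G" and "u \<noteq> v"
proof -
  have "{u, v} \<in> [verts G]\<^bsup>2\<^esup>"
    using assms unfolding simple_graph_def by blast
  then show "u \<in> verts G" and "v \<in> verts G" and "u \<noteq> v"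
    by simp_all
qed

lemma verts_induce [simp]: "verts (induce G S) = S"
  by (simp add: induce_def)

lemma doubleton_in_edges_induce [simp]:
  "{u, v} \<in> edges (induce G S) \<longleftrightarrow> {u, v} \<in> edges G \<and> u \<in> S \<and> v \<in> S"
  by (auto simp: induce_def)

lemma induce_induce: "T \<subseteq> S \<Longrightarrow> induce (induce G S) T = induce G T"
  by (auto simp: induce_def)

lemma simple_graph_induce:
  "simple_graph G \<Longrightarrow> S \<subseteq> verts G \<Longrightarrow> simple_graph (induce G S)"
  unfolding simple_graph_def induce_def by (auto simp: nsets_def intro: finite_subset)

text \<open>Translates the cliques inside \<open>clique_number\<close> into the predicate
  \<open>clique\<close> that Ramsey's theorem uses.\<close>

lemma nsets_2_subset_iff_clique: "[K]\<^bsup>2\<^esup> \<subseteq> E \<longleftrightarrow> clique K E"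
  by (auto simp: nsets_2_eq clique_def)

lemma finite_clique_cards:
  "finite (verts G) \<Longrightarrow> finite {card K | K. K \<subseteq> verts G \<and> [K]\<^bsup>2\<^esup> \<subseteq> edges G}"
  by (rule finite_subset[of _ "card ` Pow (verts G)"]) auto

lemma card_le_clique_number:
  assumes "finite (verts G)" and "K \<subseteq> verts G" and "clique K (edges G)"
  shows "card K \<le> clique_number G"
  unfolding clique_number_def
  by (rule Max_ge[OF finite_clique_cards[OF assms(1)]])
    (use assms in \<open>auto simp: nsets_2_subset_iff_clique\<close>)

lemma clique_number_le:
  assumes "finite (verts G)"
    and "\<And>K. K \<subseteq> verts G \<Longrightarrow> clique K (edges G) \<Longrightarrow> card K \<le> n"
  shows "clique_number G \<le> n"
  unfolding clique_number_def
proof (rule Max.boundedI[OF finite_clique_cards[OF assms(1)]])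
  \<comment> \<open>The empty clique keeps the set nonempty, even in the graph without
    vertices.\<close>
  show "{card K | K. K \<subseteq> verts G \<and> [K]\<^bsup>2\<^esup> \<subseteq> edges G} \<noteq> {}"
    by (auto simp: nsets_2_subset_iff_clique intro: exI[of _ "{}"])
qed (use assms in \<open>auto simp: nsets_2_subset_iff_clique\<close>)

section \<open>Colourings: greedy bound and unions\<close>

lemma chromatic_number_le: "colourable G k \<Longrightarrow> chromatic_number G \<le> k"
  unfolding chromatic_number_def by (rule Least_le)

lemma colourable_mono: "colourable G k \<Longrightarrow> k \<le> l \<Longrightarrow> colourable G l"
  unfolding colourable_def by (meson order_less_le_trans)

text \<open>Edges leaving the vertex set impose no constraint on a colouring. The later lemmas can
  thus keep one edge set and vary only the vertices.\<close>

lemma colourable_induce: "colourable (induce G S) k \<longleftrightarrow> colourable (S, edges G) k"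
  by (auto simp: colourable_def)

text \<open>Add the vertices one at a time: degrees within a subset are no larger, and at most
  \<open>d\<close> of the \<open>Suc d\<close> colours are blocked at the new vertex. Since
  \<open>E\<close> is an arbitrary set family, loops must be excluded explicitly.\<close>

lemma colourable_greedy:
  assumes "finite S" and "\<And>v. {v} \<notin> E"
    and "\<And>v. v \<in> S \<Longrightarrow> card {u \<in> S. {u, v} \<in> E} \<le> d"
  shows "colourable (S, E) (Suc d)"
  using assms(1,3)
proof (induction S rule: finite_induct)
  case empty
  then show ?case
    by (simp add: colourable_def)
next
  case (insert x S)
  have "card {u \<in> S. {u, v} \<in> E} \<le> d" if "v \<in> S" for v
    using insert.prems[of v] that insert.hyps(1)
      card_mono[of "{u \<in> insert x S. {u, v} \<in> E}" "{u \<in> S. {u, v} \<in> E}"] by fastforce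
  from insert.IH[OF this] obtain c where
    c: "\<And>v. v \<in> S \<Longrightarrow> c v < Suc d" "\<And>u v. u \<in> S \<Longrightarrow> v \<in> S \<Longrightarrow> {u, v} \<in> E \<Longrightarrow> c u \<noteq> c v"
    unfolding colourable_def by auto
  define N where "N = {u \<in> S. {u, x} \<in> E}"
  have "card N \<le> card {u \<in> insert x S. {u, x} \<in> E}"
    unfolding N_def using insert.hyps(1) by (intro card_mono) auto
  then have "card N \<le> d"
    using insert.prems[of x] by simp
  then have "card (c ` N) < card {..<Suc d}"
    using card_image_le[of N c] insert.hyps(1) by (simp add: N_def)
  then have "\<not> {..<Suc d} \<subseteq> c ` N"
    using card_mono[of "c ` N" "{..<Suc d}"] insert.hyps(1) by (auto simp: N_def)
  then obtain i where i: "i < Suc d" "i \<notin> c ` N"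
    by auto
  show ?case
    unfolding colourable_def
  proof (intro exI[of _ "c(x := i)"] conjI ballI impI)
    fix u v
    assume uv: "u \<in> verts (insert x S, E)" "v \<in> verts (insert x S, E)" "{u, v} \<in> edges (insert x S, E)"
    have "u \<noteq> v"
      using assms(2) uv(3) by auto
    with uv i(2) c(2) insert.hyps(2) show "(c(x := i)) u \<noteq> (c(x := i)) v"
      by (auto simp: N_def image_iff insert_commute)
  qed (use c i insert.hyps in auto)
qed

text \<open>The least number of colours is attained once some number works; the greedy bound with
  the trivial degree bound \<open>card (verts G)\<close> supplies one.\<close>

lemma colourable_chromatic_number:
  assumes "simple_graph G"
  shows "colourable G (chromatic_number G)"
proof -
  have fin: "finite (verts G)"
    using assms by (simp add: simple_graph_def)
  have "colourable (verts G, edges G) (Suc (card (verts G)))"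
  proof (rule colourable_greedy[OF fin])
    show "{v} \<notin> edges G" for v
      using simple_graph_edgeD(3)[OF assms, of v v] by auto
    show "card {u \<in> verts G. {u, v} \<in> edges G} \<le> card (verts G)" for v
      by (rule card_mono[OF fin]) auto
  qed
  then show ?thesis
    unfolding chromatic_number_def by (simp add: LeastI)
qed

lemma colourable_Un:
  assumes "colourable (A, E) a" and "colourable (B, E) b"
  shows "colourable (A \<union> B, E) (a + b)"
proof -
  obtain c where
    c: "\<And>v. v \<in> A \<Longrightarrow> c v < a" "\<And>u v. u \<in> A \<Longrightarrow> v \<in> A \<Longrightarrow> {u, v} \<in> E \<Longrightarrow> c u \<noteq> c v"
    using assms(1) unfolding colourable_def by auto
  obtain d where
    d: "\<And>v. v \<in> B \<Longrightarrow> d v < b" "\<And>u v. u \<in> B \<Longrightarrow> v \<in> B \<Longrightarrow> {u, v} \<in> E \<Longrightarrow> d u \<noteq> d v"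
    using assms(2) unfolding colourable_def by auto
  show ?thesis
    unfolding colourable_def
  \<comment> \<open>The palettes are kept disjoint by shifting the second one by \<open>a\<close>; a
    vertex in both sets gets its colour from \<open>A\<close>.\<close>
  proof (intro exI[of _ "\<lambda>v. if v \<in> A then c v else a + d v"] conjI ballI impI)
    show "(if v \<in> A then c v else a + d v) < a + b" if "v \<in> verts (A \<union> B, E)" for v
      using c(1)[of v] d(1)[of v] that by auto
    show "(if u \<in> A then c u else a + d u) \<noteq> (if v \<in> A then c v else a + d v)"
      if "u \<in> verts (A \<union> B, E)" "v \<in> verts (A \<union> B, E)" "{u, v} \<in> edges (A \<union> B, E)" for u v
      using c(1)[of u] c(1)[of v] c(2)[of u v] d(2)[of u v] that by auto
  qed
qed

lemma chromatic_number_induce_le_upto: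
  assumes "finite (verts G)" and "S \<subseteq> verts G" and "clique_number (induce G S) \<le> n"
  shows "chromatic_number (induce G S) \<le> chromatic_number_upto n G"
  unfolding chromatic_number_upto_def
proof (rule Max_ge)
  show "finite {chromatic_number (induce G S) | S. S \<subseteq> verts G \<and> clique_number (induce G S) \<le> n}"
    using assms(1) by (rule_tac finite_subset[of _ "(\<lambda>S. chromatic_number (induce G S)) ` Pow (verts G)"]) auto
qed (use assms in auto)

section \<open>Hereditary classes\<close>

text \<open>The preimage of \<open>S\<close> under the isomorphism serves as \<open>T\<close>. This
  pulls a forbidden induced subgraph back to an isomorphic graph.\<close>

lemma graph_iso_induce:
  assumes "graph_iso G H" and "S \<subseteq> verts H"
  shows "\<exists>T\<subseteq>verts G. graph_iso (induce G T) (induce H S)"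
proof -
  obtain f where f: "bij_betw f (verts G) (verts H)"
    "\<And>u v. u \<in> verts G \<Longrightarrow> v \<in> verts G \<Longrightarrow> {u, v} \<in> edges G \<longleftrightarrow> {f u, f v} \<in> edges H"
    using assms(1) unfolding graph_iso_def by blast
  define T where "T = {u \<in> verts G. f u \<in> S}"
  have "f ` T = S"
    using f(1) assms(2) by (auto simp: T_def bij_betw_def image_iff subset_iff)
  then have "bij_betw f T S"
    using bij_betw_subset[OF f(1), of T S] by (auto simp: T_def)
  then have "graph_iso (induce G T) (induce H S)"
    unfolding graph_iso_def using f(2) by (auto simp: T_def intro!: exI[of _ f])
  then show ?thesis
    by (intro exI[of _ T]) (auto simp: T_def)
qed

lemma graph_iso_trans:
  assumes "graph_iso G H" and "graph_iso H K"
  shows "graph_iso G K"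
proof -
  obtain f where f: "bij_betw f (verts G) (verts H)"
    "\<And>u v. u \<in> verts G \<Longrightarrow> v \<in> verts G \<Longrightarrow> {u, v} \<in> edges G \<longleftrightarrow> {f u, f v} \<in> edges H"
    using assms(1) unfolding graph_iso_def by blast
  obtain g where g: "bij_betw g (verts H) (verts K)"
    "\<And>u v. u \<in> verts H \<Longrightarrow> v \<in> verts H \<Longrightarrow> {u, v} \<in> edges H \<longleftrightarrow> {g u, g v} \<in> edges K"
    using assms(2) unfolding graph_iso_def by blast
  have "f u \<in> verts H" if "u \<in> verts G" for u
    using f(1) that by (auto simp: bij_betw_def)
  then show ?thesis
    unfolding graph_iso_def using bij_betw_trans[OF f(1) g(1)] f(2) g(2)
    by (auto intro!: exI[of _ "g \<circ> f"])
qed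

section \<open>Closure properties of classes given by forbidden induced subgraphs\<close>

lemma not_free_ofI: "S \<subseteq> verts G \<Longrightarrow> graph_iso (induce G S) H \<Longrightarrow> \<not> free_of H G"
  by (auto simp: free_of_def)

lemma free_of_induce:
  assumes "free_of H G" and "S \<subseteq> verts G"
  shows "free_of H (induce G S)"
  unfolding free_of_def
proof
  assume "\<exists>T\<subseteq>verts (induce G S). graph_iso (induce (induce G S) T) H"
  then obtain T where "T \<subseteq> S" "graph_iso (induce G T) H"
    by (auto simp: induce_induce)
  with assms show False
    unfolding free_of_def by blast
qed

lemma free_of_iso:
  assumes "free_of H G" and "graph_iso G G'"
  shows "free_of H G'"
  unfolding free_of_def
proof
  assume "\<exists>S\<subseteq>verts G'. graph_iso (induce G' S) H"
  then obtain S where S: "S \<subseteq> verts G'" "graph_iso (induce G' S) H"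
    by auto
  obtain T where T: "T \<subseteq> verts G" "graph_iso (induce G T) (induce G' S)"
    using graph_iso_induce[OF assms(2) S(1)] by auto
  show False
    using assms(1) T(1) graph_iso_trans[OF T(2) S(2)] by (auto simp: free_of_def)
qed

lemma hereditary_free_class: "hereditary (free_class \<H>)"
  by (simp add: hereditary_def graph_class_def free_class_def simple_graph_induce free_of_induce
      del: split_paired_All split_paired_Ex) (meson free_of_iso)

lemma hereditary_Int: "hereditary \<F> \<Longrightarrow> hereditary \<G> \<Longrightarrow> hereditary (\<F> \<inter> \<G>)"
  unfolding hereditary_def graph_class_def by blast

section \<open>Finding the forbidden graphs\<close>

text \<open>
  Each forbidden graph is a blow-up: its vertices fall into parts, and whether two distinct vertices are
  adjacent depends only on their parts.
\<close>

lemma graph_iso_blowup: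
  fixes p :: "'a \<Rightarrow> 'c" and q :: "'b \<Rightarrow> 'c"
  assumes "finite S" and "finite (verts H)"
    and card: "\<And>i. card {x \<in> S. p x = i} = card {y \<in> verts H. q y = i}"
    and G: "\<And>x y. x \<in> S \<Longrightarrow> y \<in> S \<Longrightarrow> {x, y} \<in> edges G \<longleftrightarrow> x \<noteq> y \<and> M (p x) (p y)"
    and H: "\<And>x y. x \<in> verts H \<Longrightarrow> y \<in> verts H \<Longrightarrow> {x, y} \<in> edges H \<longleftrightarrow> x \<noteq> y \<and> M (q x) (q y)"
  shows "graph_iso (induce G S) H"
proof -
  have "\<exists>f. bij_betw f {x \<in> S. p x = i} {y \<in> verts H. q y = i}" for i
    using card[of i] assms(1,2) by (intro finite_same_card_bij) auto
  then obtain f where f: "\<And>i. bij_betw (f i) {x \<in> S. p x = i} {y \<in> verts H. q y = i}"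
    by metis
  \<comment> \<open>Glue the bijections between corresponding parts. As
    \<open>q (g x) = p x\<close>, distinct parts stay apart and \<open>M\<close> prescribes the same
    adjacency on both sides.\<close>
  define g where "g x = f (p x) x" for x
  have g: "g x \<in> verts H \<and> q (g x) = p x" if "x \<in> S" for x
    using bij_betw_apply[OF f, of x "p x"] that by (simp add: g_def)
  have inj: "inj_on g S"
  proof (rule inj_onI)
    fix x y
    assume xy: "x \<in> S" "y \<in> S" "g x = g y"
    then have "p x = p y"
      using g by metis
    with xy show "x = y"
      using inj_onD[OF bij_betw_imp_inj_on[OF f[of "p x"]], of x y] by (simp add: g_def)
  qed
  have "verts H \<subseteq> g ` S"
  proof
    fix y
    assume "y \<in> verts H"
    then have "y \<in> f (q y) ` {x \<in> S. p x = q y}"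
      using bij_betw_imp_surj_on[OF f[of "q y"]] by simp
    then show "y \<in> g ` S"
      by (force simp: g_def)
  qed
  with g inj have "bij_betw g S (verts H)"
    by (auto simp: bij_betw_def)
  moreover have "{x, y} \<in> edges G \<longleftrightarrow> {g x, g y} \<in> edges H" if "x \<in> S" "y \<in> S" for x y
    using G[of x y] H[of "g x" "g y"] g that inj_on_eq_iff[OF inj that] by simp
  ultimately show ?thesis
    unfolding graph_iso_def by auto
qed

text \<open>\<open>F1\<close> and \<open>F2\<close> differ only in the number of independent
  vertices, so one argument serves both.\<close>

lemma not_free_of_F:
  assumes G: "simple_graph G" and KI: "K \<subseteq> verts G" "I \<subseteq> verts G" "K \<inter> I = {}"
    and K: "clique K (edges G)" and I: "indep I (edges G)"
    and join: "\<And>x y. x \<in> K \<Longrightarrow> y \<in> I \<Longrightarrow> {x, y} \<in> edges G"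
    and H: "H = F1 (card K) \<and> card I = 2 \<or> H = F2 (card K) \<and> card I = 3"
  shows "\<not> free_of H G"
proof -
  let ?t = "card K"
  have fin: "finite K" "finite I"
    using G KI finite_subset unfolding simple_graph_def by auto
  have verts: "verts H = {..<?t + card I}"
    using H by (auto simp: F1_def F2_def)
  have edges: "edges H = [{..<?t}]\<^bsup>2\<^esup> \<union> {{u, v} | u v. u \<in> {..<?t} \<and> v \<in> {?t..<?t + card I}}"
    using H by (elim disjE) (simp_all add: F1_def F2_def)
  have "graph_iso (induce G (K \<union> I)) H"
  \<comment> \<open>Two parts, named by truth values: \<open>True\<close> for the clique. Only pairs
    inside the independent part are non-adjacent, hence the disjunction.\<close>
  proof (rule graph_iso_blowup[where p = "\<lambda>x. x \<in> K" and q = "\<lambda>y. y < ?t" and M = "(\<or>)"])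
    fix i
    have "{x \<in> K \<union> I. x \<in> K} = K" "{x \<in> K \<union> I. x \<notin> K} = I"
      using KI(3) by auto
    moreover have "{y \<in> verts H. y < ?t} = {..<?t}" "{y \<in> verts H. \<not> y < ?t} = {?t..<?t + card I}"
      by (auto simp: verts)
    ultimately show "card {x \<in> K \<union> I. (x \<in> K) = i} = card {y \<in> verts H. (y < ?t) = i}"
      by (cases i) auto
  next
    show "{x, y} \<in> edges G \<longleftrightarrow> x \<noteq> y \<and> (x \<in> K \<or> y \<in> K)" if "x \<in> K \<union> I" "y \<in> K \<union> I" for x y
      using that simple_graph_edgeD(3)[OF G, of x y] K I join[of x y] join[of y x]
      by (auto simp: clique_def indep_def insert_commute)
    show "{x, y} \<in> edges H \<longleftrightarrow> x \<noteq> y \<and> (x < ?t \<or> y < ?t)" if "x \<in> verts H" "y \<in> verts H" for x y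
      using that by (auto simp: edges verts doubleton_eq_iff) (metis linorder_not_le)
  qed (use fin in \<open>auto simp: verts\<close>)
  then show ?thesis
    by (rule not_free_ofI[rotated]) (use KI in simp)
qed

lemma not_free_of_bowtie:
  assumes G: "simple_graph G" and v: "v \<in> verts G" "v \<notin> C" "v \<notin> K"
    and sub: "C \<subseteq> verts G" "K \<subseteq> verts G" "C \<inter> K = {}"
    and C: "clique C (edges G)" and K: "clique K (edges G)"
    and anti: "\<And>x y. x \<in> C \<Longrightarrow> y \<in> K \<Longrightarrow> {x, y} \<notin> edges G"
    and join: "\<And>x. x \<in> C \<union> K \<Longrightarrow> {x, v} \<in> edges G"
  shows "\<not> free_of (bowtie (card C) (card K)) G"
proof -
  let ?s = "card C" and ?t = "card K" and ?S = "insert v (C \<union> K)"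
  let ?H = "bowtie ?s ?t"
  define p where "p x = (if x = v then 0 else if x \<in> C then 1 else 2 :: nat)" for x
  define q where "q y = (if y = ?s + ?t then 0 else if y < ?s then 1 else 2 :: nat)" for y
  have fin: "finite C" "finite K"
    using G sub finite_subset unfolding simple_graph_def by auto
  have "graph_iso (induce G ?S) ?H"
  \<comment> \<open>Part 0 is the centre, parts 1 and 2 are the two cliques; the centre sees
    everything and other edges stay within a part.\<close>
  proof (rule graph_iso_blowup[where p = p and q = q and M = "\<lambda>i j. i = 0 \<or> j = 0 \<or> i = j"])
    fix i
    have "{x \<in> ?S. p x = i} = (if i = 0 then {v} else if i = 1 then C else if i = 2 then K else {})"
      using v sub(3) by (auto simp: p_def)
    moreover have "{y \<in> verts ?H. q y = i} = (if i = 0 then {?s + ?t} else if i = 1 then {..<?s}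
        else if i = 2 then {?s..<?s + ?t} else {})"
      by (auto simp: q_def bowtie_def)
    ultimately show "card {x \<in> ?S. p x = i} = card {y \<in> verts ?H. q y = i}"
      by simp
  next
    show "{x, y} \<in> edges G \<longleftrightarrow> x \<noteq> y \<and> (p x = 0 \<or> p y = 0 \<or> p x = p y)" if "x \<in> ?S" "y \<in> ?S" for x y
      using that simple_graph_edgeD(3)[OF G, of x y] C K anti[of x y] anti[of y x] join[of x] join[of y] v sub(3)
      by (auto simp: clique_def p_def insert_commute)
    show "{x, y} \<in> edges ?H \<longleftrightarrow> x \<noteq> y \<and> (q x = 0 \<or> q y = 0 \<or> q x = q y)"
      if "x \<in> verts ?H" "y \<in> verts ?H" for x y
      using that by (auto simp: bowtie_def q_def doubleton_eq_iff)
  qed (use fin in \<open>auto simp: bowtie_def\<close>)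
  then show ?thesis
    by (rule not_free_ofI[rotated]) (use v sub in simp)
qed

text \<open>The vertex \<open>v\<close> is the centre of the star and \<open>I\<close> its set of
  leaves; \<open>Suc\<close> appears because the star's size counts its centre.\<close>

lemma not_free_of_lollipop:
  assumes G: "simple_graph G" and v: "v \<in> verts G" "v \<notin> I" "v \<notin> K"
    and sub: "I \<subseteq> verts G" "K \<subseteq> verts G" "I \<inter> K = {}"
    and I: "indep I (edges G)" and K: "clique K (edges G)"
    and anti: "\<And>x y. x \<in> I \<Longrightarrow> y \<in> K \<Longrightarrow> {x, y} \<notin> edges G"
    and join: "\<And>x. x \<in> I \<union> K \<Longrightarrow> {x, v} \<in> edges G"
  shows "\<not> free_of (lollipop (Suc (card I)) (card K)) G"
proof -
  let ?k = "Suc (card I)" and ?t = "card K" and ?S = "insert v (I \<union> K)"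
  let ?H = "lollipop ?k ?t"
  define p where "p x = (if x = v then 0 else if x \<in> K then 1 else 2 :: nat)" for x
  define q where "q y = (if y = ?t then 0 else if y < ?t then 1 else 2 :: nat)" for y
  have fin: "finite I" "finite K"
    using G sub finite_subset unfolding simple_graph_def by auto
  have "graph_iso (induce G ?S) ?H"
  \<comment> \<open>Unlike in the bowtie, part 2 is independent, so away from the centre only pairs
    within part 1 are adjacent.\<close>
  proof (rule graph_iso_blowup[where p = p and q = q and M = "\<lambda>i j. i = 0 \<or> j = 0 \<or> i = 1 \<and> j = 1"])
    fix i
    have "{x \<in> ?S. p x = i} = (if i = 0 then {v} else if i = 1 then K else if i = 2 then I else {})"
      using v sub(3) by (auto simp: p_def)
    moreover have "{y \<in> verts ?H. q y = i} = (if i = 0 then {?t} else if i = 1 then {..<?t}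
        else if i = 2 then {?t<..<?t + ?k} else {})"
      by (auto simp: q_def lollipop_def)
    ultimately show "card {x \<in> ?S. p x = i} = card {y \<in> verts ?H. q y = i}"
      by simp
  next
    show "{x, y} \<in> edges G \<longleftrightarrow> x \<noteq> y \<and> (p x = 0 \<or> p y = 0 \<or> p x = 1 \<and> p y = 1)"
      if "x \<in> ?S" "y \<in> ?S" for x y
      using that simple_graph_edgeD(3)[OF G, of x y] I K anti[of x y] anti[of y x] join[of x] join[of y] v sub(3)
      by (auto simp: clique_def indep_def p_def insert_commute)
    show "{x, y} \<in> edges ?H \<longleftrightarrow> x \<noteq> y \<and> (q x = 0 \<or> q y = 0 \<or> q x = 1 \<and> q y = 1)"
      if "x \<in> verts ?H" "y \<in> verts ?H" for x y
      using that by (auto simp: lollipop_def q_def doubleton_eq_iff)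
  qed (use fin in \<open>auto simp: lollipop_def\<close>)
  then show ?thesis
    by (rule not_free_ofI[rotated]) (use v sub in simp)
qed

section \<open>Degrees of vertices in large cliques\<close>

text \<open>Every vertex outside a maximum clique \<open>Q\<close> misses some \<open>q\<close> in
  \<open>Q\<close>. The non-neighbours of \<open>q\<close> form a clique, as two non-adjacent ones
  would give an independent triple with \<open>q\<close>. So \<open>Q\<close> and at most
  \<open>w\<close> sets of size at most \<open>w\<close> cover \<open>U\<close>.\<close>

lemma card_le_if_no_indep_triple:
  assumes "finite U"
    and indep: "\<And>I. I \<subseteq> U \<Longrightarrow> card I = 3 \<Longrightarrow> \<not> indep I E"
    and clique: "\<And>K. K \<subseteq> U \<Longrightarrow> clique K E \<Longrightarrow> card K \<le> w"
  shows "card U \<le> w + w * w"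
proof -
  have "\<exists>Q. (Q \<subseteq> U \<and> clique Q E) \<and> (\<forall>Q'. Q' \<subseteq> U \<and> clique Q' E \<longrightarrow> card Q' \<le> card Q)"
    by (rule ex_has_greatest_nat[of _ "{}" card "Suc w"]) (use clique in \<open>auto simp: less_Suc_eq_le\<close>)
  then obtain Q where Q: "Q \<subseteq> U" "clique Q E"
    and max: "\<And>Q'. Q' \<subseteq> U \<Longrightarrow> clique Q' E \<Longrightarrow> card Q' \<le> card Q"
    by blast
  have finQ: "finite Q"
    using Q(1) assms(1) finite_subset by blast
  define N where "N q = {u \<in> U. u \<noteq> q \<and> {u, q} \<notin> E}" for q
  have U: "U \<subseteq> Q \<union> (\<Union>q\<in>Q. N q)"
  proof
    fix u
    assume u: "u \<in> U"
    show "u \<in> Q \<union> (\<Union>q\<in>Q. N q)"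
    proof (rule ccontr)
      assume "u \<notin> Q \<union> (\<Union>q\<in>Q. N q)"
      then have "u \<notin> Q" and "\<forall>q\<in>Q. {u, q} \<in> E"
        using u by (auto simp: N_def)
      then have "clique (insert u Q) E"
        using Q(2) by (auto simp: clique_def insert_commute)
      then have "card (insert u Q) \<le> card Q"
        using u Q(1) by (intro max) auto
      with \<open>u \<notin> Q\<close> finQ show False
        by simp
    qed
  qed
  have N: "card (N q) \<le> w" if "q \<in> Q" for q
  proof (rule clique)
    show "clique (N q) E"
      unfolding clique_def
    proof (intro ballI impI, rule ccontr)
      fix x y
      assume xy: "x \<in> N q" "y \<in> N q" "x \<noteq> y" "{x, y} \<notin> E"
      then have "indep {x, y, q} E"
        by (auto simp: N_def indep_def insert_commute)
      moreover have "card {x, y, q} = 3" "{x, y, q} \<subseteq> U"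
        using xy that Q(1) by (auto simp: N_def)
      ultimately show False
        using indep by blast
    qed
  qed (auto simp: N_def)
  have "card (\<Union>q\<in>Q. N q) \<le> card Q * w"
    using card_UN_le[OF finQ, of N] sum_bounded_above[of Q "\<lambda>q. card (N q)" w] N by simp
  also have "\<dots> \<le> w * w"
    using clique[OF Q] by simp
  finally have "card (\<Union>q\<in>Q. N q) \<le> w * w" .
  moreover have "card U \<le> card (Q \<union> (\<Union>q\<in>Q. N q))"
    using U finQ assms(1) by (intro card_mono) (auto simp: N_def)
  ultimately show ?thesis
    using card_Un_le[of Q "\<Union>q\<in>Q. N q"] clique[OF Q] by linarith
qed

text \<open>An independent triple among the common neighbours of \<open>K\<close> yields
  \<open>F2 t\<close>, and any two of its vertices yield \<open>F1 t\<close>; so the triple bound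
  covers both choices of \<open>Y\<close>.\<close>

lemma card_complete_le:
  assumes G: "simple_graph G" and Y: "free_of Y G" "Y \<in> {F1 t, F2 t}"
    and K: "K \<subseteq> verts G" "clique K (edges G)" "card K = t"
  shows "card {u \<in> verts G. \<forall>x\<in>K. {x, u} \<in> edges G} \<le> clique_number G + clique_number G * clique_number G"
    (is "card ?U \<le> _")
proof (rule card_le_if_no_indep_triple)
  have fin: "finite (verts G)"
    using G by (simp add: simple_graph_def)
  then show "finite ?U"
    by simp
  show "card Q \<le> clique_number G" if "Q \<subseteq> ?U" "clique Q (edges G)" for Q
    using card_le_clique_number[OF fin _ that(2)] that(1) by blast
  show "\<not> indep I (edges G)" if I: "I \<subseteq> ?U" "card I = 3" for I
  proof
    assume indep: "indep I (edges G)"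
    obtain J where J: "J \<subseteq> I" "card J = (if Y = F1 t then 2 else 3)"
      using obtain_subset_with_card_n[of _ I] I(2)
      by (metis (full_types) eval_nat_numeral(3) le_SucI order_refl)
    have "K \<inter> J = {}"
      using I(1) J(1) simple_graph_edgeD(3)[OF G] by blast
    moreover have "J \<subseteq> verts G" "\<And>x y. x \<in> K \<Longrightarrow> y \<in> J \<Longrightarrow> {x, y} \<in> edges G"
      using I(1) J(1) by blast+
    ultimately have "\<not> free_of Y G"
      using not_free_of_F[OF G K(1) _ _ K(2) smaller_indep[OF indep J(1)], of Y] J(2) K(3) Y(2)
      by (auto split: if_splits)
    with Y(1) show False
      by simp
  qed
qed

text \<open>With \<open>r\<close> vertices, Ramsey's theorem would produce a clique of size
  \<open>s\<close> or an independent set of size \<open>k - 1\<close>. Together with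
  \<open>K\<close> and the common neighbour \<open>v\<close>, this is a bowtie or a lollipop. Taking
  \<open>r\<close> as a parameter allows one value for all graphs.\<close>

lemma card_anticomplete_less:
  fixes G :: "'a graph"
  assumes G: "simple_graph G" and free: "free_of (bowtie s t) G" "free_of (lollipop k t) G" and "k \<ge> 1"
    and r: "\<And>V (E :: 'a set set). finite V \<Longrightarrow> r \<le> card V \<Longrightarrow>
      \<exists>R\<subseteq>V. card R = s \<and> clique R E \<or> card R = k - 1 \<and> indep R E"
    and K: "K \<subseteq> verts G" "clique K (edges G)" "card K = t" "\<And>x. x \<in> K \<Longrightarrow> {x, v} \<in> edges G"
    and v: "v \<in> verts G"
  shows "card {u \<in> verts G - K. {u, v} \<in> edges G \<and> (\<forall>x\<in>K. {u, x} \<notin> edges G)} < r"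
    (is "card ?W < r")
proof (rule ccontr)
  assume "\<not> card ?W < r"
  moreover have "finite ?W"
    using G by (simp add: simple_graph_def)
  ultimately have "\<exists>R\<subseteq>?W. card R = s \<and> clique R (edges G) \<or> card R = k - 1 \<and> indep R (edges G)"
    by (intro r) simp_all
  then obtain R where R: "R \<subseteq> ?W"
    "card R = s \<and> clique R (edges G) \<or> card R = k - 1 \<and> indep R (edges G)"
    by (elim exE conjE) (rule that)
  have vv: "{v, v} \<notin> edges G"
    using simple_graph_edgeD(3)[OF G, of v v] by blast
  have RD: "x \<in> verts G" "x \<notin> K" "{x, v} \<in> edges G" "\<forall>y\<in>K. {x, y} \<notin> edges G" if "x \<in> R" for x
    using subsetD[OF R(1) that] by simp_all
  have R': "R \<subseteq> verts G" "R \<inter> K = {}"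
    using RD(1,2) by auto
  have vR: "v \<notin> R" and vK: "v \<notin> K"
    using RD(3)[of v] K(4)[of v] vv by auto
  have anti: "{x, y} \<notin> edges G" if "x \<in> R" "y \<in> K" for x y
    using RD(4)[OF that(1)] that(2) by (rule bspec)
  have join: "{x, v} \<in> edges G" if "x \<in> R \<union> K" for x
    using that by (elim UnE) (fact RD(3) K(4))+
  from R(2) show False
  proof (elim disjE conjE)
    assume R: "card R = s" "clique R (edges G)"
    have "\<not> free_of (bowtie (card R) (card K)) G"
      by (rule not_free_of_bowtie[OF G v vR vK R'(1) K(1) R'(2) R(2) K(2) anti join])
    then show False
      using free(1) K(3) R(1) by simp
  next
    assume R: "card R = k - 1" "indep R (edges G)"
    have "\<not> free_of (lollipop (Suc (card R)) (card K)) G"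
      by (rule not_free_of_lollipop[OF G v vR vK R'(1) K(1) R'(2) R(2) K(2) anti join])
    then show False
      using free(2) K(3) R(1) \<open>k \<ge> 1\<close> by simp
  qed
qed

text \<open>Each neighbour of \<open>v\<close> outside \<open>K\<close> is charged to a
  \<open>t\<close>-subset \<open>L\<close> of \<open>K\<close> to which it is complete or
  anticomplete. The binomial coefficient counts these subsets, and the leading term accounts for
  \<open>K\<close> itself.\<close>

lemma degree_in_clique_le:
  fixes G :: "'a graph" and s t k r :: nat
  defines "w \<equiv> clique_number G"
  assumes G: "simple_graph G" and t: "t \<ge> 1" and Y: "free_of Y G" "Y \<in> {F1 t, F2 t}"
    and free: "free_of (bowtie s t) G" "free_of (lollipop k t) G" "k \<ge> 1"
    and r: "\<And>V (E :: 'a set set). finite V \<Longrightarrow> r \<le> card V \<Longrightarrow>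
      \<exists>R\<subseteq>V. card R = s \<and> clique R E \<or> card R = k - 1 \<and> indep R E"
    and K: "K \<subseteq> verts G" "clique K (edges G)" "card K = 2 * t - 1" "v \<in> K"
  shows "card {u \<in> verts G. {u, v} \<in> edges G} \<le> 2 * t - 1 + ((2 * t - 1) choose t) * (w + w * w + r)"
proof -
  have fin: "finite (verts G)" "finite K"
    using G K(1) finite_subset by (auto simp: simple_graph_def)
  define U where "U L = {u \<in> verts G. \<forall>x\<in>L. {x, u} \<in> edges G}" for L
  define W where "W L = {u \<in> verts G - L. {u, v} \<in> edges G \<and> (\<forall>x\<in>L. {u, x} \<notin> edges G)}" for L
  have finUW: "finite (U L)" "finite (W L)" for L
    using fin by (auto simp: U_def W_def)
  have "card (U L \<union> W L) \<le> w + w * w + r" if "L \<in> [K]\<^bsup>t\<^esup>" for L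
  proof -
    have L: "L \<subseteq> K" "card L = t"
      using that by (auto simp: nsets_def)
    then have L': "L \<subseteq> verts G" "clique L (edges G)"
      using K smaller_clique by blast+
    \<comment> \<open>If \<open>v\<close> is in \<open>L\<close>, a vertex of \<open>W L\<close>
      would be both adjacent and non-adjacent to \<open>v\<close>. Otherwise \<open>L\<close>
      consists of neighbours of \<open>v\<close>, as the Ramsey bound requires.\<close>
    have "card (W L) \<le> r"
    proof (cases "v \<in> L")
      case True
      then have "W L = {}"
        by (auto simp: W_def)
      then show ?thesis
        by simp
    next
      case False
      then have "{x, v} \<in> edges G" if "x \<in> L" for x
        using that L(1) K(2,4) by (auto simp: clique_def)
      from card_anticomplete_less[OF G free r L' L(2) this] K(1,4) show ?thesis
        unfolding W_def by (meson less_imp_le subsetD)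
    qed
    moreover have "card (U L) \<le> w + w * w"
      unfolding U_def w_def by (rule card_complete_le[OF G Y L' L(2)])
    ultimately show ?thesis
      using card_Un_le[of "U L" "W L"] by linarith
  qed
  then have "card (\<Union>L\<in>[K]\<^bsup>t\<^esup>. U L \<union> W L) \<le> card ([K]\<^bsup>t\<^esup>) * (w + w * w + r)"
    using card_UN_le[OF finite_imp_finite_nsets[OF fin(2), of t], of "\<lambda>L. U L \<union> W L"]
      sum_bounded_above[of "[K]\<^bsup>t\<^esup>" "\<lambda>L. card (U L \<union> W L)" "w + w * w + r"] by simp
  then have bound: "card (\<Union>L\<in>[K]\<^bsup>t\<^esup>. U L \<union> W L) \<le> ((2 * t - 1) choose t) * (w + w * w + r)"
    by (simp add: K(3))
  have "{u \<in> verts G. {u, v} \<in> edges G} \<subseteq> K \<union> (\<Union>L\<in>[K]\<^bsup>t\<^esup>. U L \<union> W L)"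
  proof
    fix u
    assume "u \<in> {u \<in> verts G. {u, v} \<in> edges G}"
    then have u: "u \<in> verts G" "{u, v} \<in> edges G"
      by auto
    define A where "A = {x \<in> K. {x, u} \<in> edges G}"
    have "A \<subseteq> K" and cardK: "card A + card (K - A) = 2 * t - 1"
      using card_Diff_subset[of A K] card_mono[of K A] fin(2) K(3)
      by (auto simp: A_def)
    show "u \<in> K \<union> (\<Union>L\<in>[K]\<^bsup>t\<^esup>. U L \<union> W L)"
    proof (cases "u \<in> K")
      case False
      \<comment> \<open>This is where the clique size \<open>2 * t - 1\<close> enters: two parts of
        size at most \<open>t - 1\<close> would total at most \<open>2 * t - 2\<close>.\<close>
      consider "t \<le> card A" | "t \<le> card (K - A)"
        using cardK t by linarith
      then show ?thesis
      proof cases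
        case 1
        then obtain L where "L \<subseteq> A" "card L = t" "finite L"
          by (rule obtain_subset_with_card_n)
        then have "L \<in> [K]\<^bsup>t\<^esup>" "u \<in> U L"
          using u by (auto simp: nsets_def U_def A_def)
        then show ?thesis
          by blast
      next
        case 2
        then obtain L where "L \<subseteq> K - A" "card L = t" "finite L"
          by (rule obtain_subset_with_card_n)
        then have "L \<in> [K]\<^bsup>t\<^esup>" "u \<in> W L"
          using u False by (auto simp: nsets_def W_def A_def insert_commute)
        then show ?thesis
          by blast
      qed
    qed simp
  qed
  then have "card {u \<in> verts G. {u, v} \<in> edges G} \<le> card (K \<union> (\<Union>L\<in>[K]\<^bsup>t\<^esup>. U L \<union> W L))"
    using fin finUW finite_imp_finite_nsets[OF fin(2), of t] by (intro card_mono) auto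
  also have "\<dots> \<le> card K + card (\<Union>L\<in>[K]\<^bsup>t\<^esup>. U L \<union> W L)"
    by (rule card_Un_le)
  finally show ?thesis
    using bound K(3) by linarith
qed

section \<open>Splitting the graph and the polynomial bound\<close>

theorem theorem2p7:
  fixes s t k :: nat and Y :: "nat graph"
  assumes "s \<ge> 2" and "t \<ge> 2" and "k \<ge> 2"
    and "Y \<in> {F1 t, F2 t}"
  shows "strongly_pollyanna (2 * t - 2)
           (free_class {Y, bowtie s t, lollipop k t} :: 'a graph set)"
  unfolding strongly_pollyanna_def
proof (intro allI impI)
  fix \<F> :: "'a graph set"
  let ?C = "free_class {Y, bowtie s t, lollipop k t} :: 'a graph set"
  assume "good (2 * t - 2) \<F>"
  then obtain m where her: "hereditary \<F>" and m: "\<And>G. G \<in> \<F> \<Longrightarrow> chromatic_number_upto (2 * t - 2) G \<le> m"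
    unfolding good_def by blast
  \<comment> \<open>Fixed before any graph is chosen, so \<open>r\<close> depends only on
    \<open>s\<close> and \<open>k\<close> and may enter the coefficients of the polynomial.\<close>
  obtain r :: nat where ramsey: "\<forall>V (E :: 'a set set). finite V \<and> r \<le> card V \<longrightarrow>
      (\<exists>R\<subseteq>V. card R = s \<and> clique R E \<or> card R = k - 1 \<and> indep R E)"
    using ramsey2[of s "k - 1"] by (elim exE conjE) (rule that)
  then have r: "\<exists>R\<subseteq>V. card R = s \<and> clique R E \<or> card R = k - 1 \<and> indep R E"
    if "finite V" "r \<le> card V" for V and E :: "'a set set"
    using that by simp
  define d where "d w = 2 * t - 1 + ((2 * t - 1) choose t) * (w + w * w + r)" for w
  have bound: "chromatic_number G \<le> Suc (d (clique_number G)) + m" if "G \<in> ?C \<inter> \<F>" for G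
  proof -
    have G: "simple_graph G" "free_of Y G" "free_of (bowtie s t) G" "free_of (lollipop k t) G"
      using that by (auto simp: free_class_def)
    have fin: "finite (verts G)"
      using G(1) by (simp add: simple_graph_def)
    \<comment> \<open>Exact size suffices: every larger clique is covered by its subsets of size
      \<open>2 * t - 1\<close>.\<close>
    define A where "A = \<Union>{K. K \<subseteq> verts G \<and> clique K (edges G) \<and> card K = 2 * t - 1}"
    define B where "B = verts G - A"
    have AB: "A \<subseteq> verts G" "B \<subseteq> verts G" "A \<union> B = verts G"
      by (auto simp: A_def B_def)
    have "colourable (A, edges G) (Suc (d (clique_number G)))"
    proof (rule colourable_greedy)
      show "finite A"
        using AB(1) fin finite_subset by blast
      show "{v} \<notin> edges G" for v
        using simple_graph_edgeD(3)[OF G(1), of v v] by auto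
      fix v
      assume "v \<in> A"
      then obtain K where K: "K \<subseteq> verts G" "clique K (edges G)" "card K = 2 * t - 1" "v \<in> K"
        by (auto simp: A_def)
      have "card {u \<in> A. {u, v} \<in> edges G} \<le> card {u \<in> verts G. {u, v} \<in> edges G}"
        using AB(1) fin by (intro card_mono) auto
      also have "\<dots> \<le> d (clique_number G)"
        unfolding d_def
        by (rule degree_in_clique_le[OF G(1) _ G(2) assms(4) G(3,4) _ r K]) (use assms(2,3) in auto)
      finally show "card {u \<in> A. {u, v} \<in> edges G} \<le> d (clique_number G)" .
    qed
    moreover have "colourable (B, edges G) m"
    proof -
      have "clique_number (induce G B) \<le> 2 * t - 2"
      proof (rule clique_number_le)
        show "finite (verts (induce G B))"
          using AB(2) fin finite_subset by auto
        fix K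
        assume "K \<subseteq> verts (induce G B)" "clique K (edges (induce G B))"
        then have K: "K \<subseteq> B" "clique K (edges G)"
          by (auto simp: clique_def)
        show "card K \<le> 2 * t - 2"
        proof (rule ccontr)
          assume "\<not> card K \<le> 2 * t - 2"
          then have "2 * t - 1 \<le> card K"
            by linarith
          then obtain L where L: "L \<subseteq> K" "card L = 2 * t - 1" "finite L"
            by (rule obtain_subset_with_card_n)
          then have "L \<subseteq> A"
            using K AB(2) smaller_clique[of K "edges G" L] by (auto simp: A_def)
          \<comment> \<open>\<open>L\<close> lies both in \<open>A\<close> and in its complement
            \<open>B\<close>, yet has \<open>2 * t - 1 > 0\<close> elements.\<close>
          with L(1) K(1) have "L = {}"
            by (auto simp: B_def)
          with L(2) assms(2) show False
            by simp
        qed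
      qed
      then have "chromatic_number (induce G B) \<le> m"
        using chromatic_number_induce_le_upto[OF fin AB(2)] m[of G] that by fastforce
      then show ?thesis
        using colourable_chromatic_number[OF simple_graph_induce[OF G(1) AB(2)]]
          colourable_mono colourable_induce by blast
    qed
    ultimately have "colourable (A \<union> B, edges G) (Suc (d (clique_number G)) + m)"
      by (rule colourable_Un)
    then show ?thesis
      using chromatic_number_le[of G] AB(3) by simp
  qed
  define c where "c = real ((2 * t - 1) choose t)"
  \<comment> \<open>Coefficients are listed from the constant term up; \<open>2 * t\<close> is the
    successor of the summand \<open>2 * t - 1\<close> in \<open>d\<close>, and \<open>m\<close>
    colours the rest \<open>B\<close>.\<close>
  define f where "f = [:real (2 * t + m) + c * real r, c, c:]"
  have "real (chromatic_number G) \<le> poly f (real (clique_number G))" if "G \<in> ?C \<inter> \<F>" for G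
  proof -
    have "real (chromatic_number G) \<le> real (Suc (d (clique_number G)) + m)"
      using bound[OF that] by (rule of_nat_mono)
    also have "Suc (d (clique_number G)) + m = 2 * t + m + ((2 * t - 1) choose t) *
        (clique_number G + clique_number G * clique_number G + r)"
      using assms(2) by (simp add: d_def)
    also have "real \<dots> = poly f (real (clique_number G))"
      by (simp add: f_def c_def algebra_simps)
    finally show ?thesis .
  qed
  then show "polynomially_chi_bounded (?C \<inter> \<F>)"
    unfolding polynomially_chi_bounded_def
    using hereditary_Int[OF hereditary_free_class her] by blast
qed

end
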